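(* Let $\epsilon\in(0,1)$ and $\kappa=\sqrt{(1-\epsilon)/\epsilon}$. Let $g:\mathbb{R}^n\to\mathbb{R}$ be differentiable and $X\subseteq\mathbb{R}^n$ a closed set. Let $\tilde{\boldsymbol{\mu}}\in\mathbb{R}^n$, let $\tilde{\varSigma}\in\mathcal{S}^n$ be positive definite, let $A\in\mathbb{R}^{n\times m}$, $B\in\mathbb{R}^{n\times k}$, $\alpha\ge 0$, $\beta\ge 0$, and define $$U_{\boldsymbol{\mu}}=\{\tilde{\boldsymbol{\mu}}+A\boldsymbol{z}_1\mid\|\boldsymbol{z}_1\|_\infty\le\alpha,\ \boldsymbol{z}_1\in\mathbb{R}^m\},$$ $$U_{\varSigma}=\{\tilde{\varSigma}+BZ_2B^{\top}\mid\|Z_2\|_{\infty,\infty}\le\beta,\ Z_2\in\mathcal{S}^k\}\cap\mathcal{S}_+^n .$$ Let $\mathcal{P}$ be the set of all probability distributions on $\mathbb{R}^n$ whose expected value vector belongs to $U_{\boldsymbol{\mu}}$ and whose variance-covariance matrix belongs to $U_{\varSigma}$. Then $\tilde{\boldsymbol{x}}\in X$ satisfies $$\inf_{p\in\mathcal{P}}\mathrm{P}_p\{g(\tilde{\boldsymbol{x}})+\nabla g(\tilde{\boldsymbol{x}})^{\top}\boldsymbol{\zeta}\le 0\}\ge 1-\epsilon$$ if and only if there exists a pair of $z\in\mathbb{R}$ and $W\in\mathcal{S}^n$ satisfying $$g(\tilde{\boldsymbol{x}})+\nabla g(\tilde{\boldsymbol{x}})^{\top}\tilde{\boldsymbol{\mu}}+\alpha\|A^{\top}\nabla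 g(\tilde{\boldsymbol{x}})\|_1+\tilde{\varSigma}\bullet W+\beta\|B^{\top}WB\|_{1,1}+\kappa^2 z\le 0,$$ $$\begin{bmatrix}W & \nabla g(\tilde{\boldsymbol{x}})/2\\ \nabla g(\tilde{\boldsymbol{x}})^{\top}/2 & z\end{bmatrix}\succeq 0 .$$
   Context: $\mathcal{S}^n$ is the set of real symmetric $n\times n$ matrices; $Z\succeq 0$ means $Z$ is symmetric positive semidefinite, and $\mathcal{S}_+^n=\{Z\in\mathcal{S}^n\mid Z\succeq 0\}$. $X\bullet Y=\mathrm{tr}(X^{\top}Y)$. For vectors, $\|\boldsymbol{x}\|_1=\sum_i|x_i|$ and $\|\boldsymbol{x}\|_\infty=\max_i|x_i|$; for matrices, $\|X\|_{1,1}=\sum_{i,j}|X_{ij}|$ and $\|X\|_{\infty,\infty}=\max_{i,j}|X_{ij}|$. $\mathrm{P}_p\{\cdot\}$ denotes probability when the random vector $\boldsymbol{\zeta}\in\mathbb{R}^n$ has distribution $p$; $\tilde{\boldsymbol{x}}$ is non-random. *)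

theory Defs
  imports "HOL-Probability.Probability"
begin

text \<open>Matrices with \<open>r\<close> rows and \<open>c\<close> columns have type \<^typ>\<open>real^'c^'r\<close>.\<close>

definition symmetric_mats :: "(real^'n^'n) set"
  where "symmetric_mats = {Z. transpose Z = Z}"

definition psd :: "real^'n^'n \<Rightarrow> bool"
  where "psd Z \<longleftrightarrow> Z \<in> symmetric_mats \<and> (\<forall>v. v \<bullet> (Z *v v) \<ge> 0)"

definition pos_def :: "real^'n^'n \<Rightarrow> bool"
  where "pos_def Z \<longleftrightarrow> Z \<in> symmetric_mats \<and> (\<forall>v. v \<noteq> 0 \<longrightarrow> v \<bullet> (Z *v v) > 0)"

definition frobenius :: "real^'n^'m \<Rightarrow> real^'n^'m \<Rightarrow> real"
  where "frobenius X Y = trace (transpose X ** Y)"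

definition norm_1 :: "real^'n \<Rightarrow> real"
  where "norm_1 x = (\<Sum>i\<in>UNIV. \<bar>x $ i\<bar>)"

definition norm_1_1 :: "real^'n^'m \<Rightarrow> real"
  where "norm_1_1 X = (\<Sum>i\<in>UNIV. \<Sum>j\<in>UNIV. \<bar>X $ i $ j\<bar>)"

definition norm_inf_inf :: "real^'n^'m \<Rightarrow> real"
  where "norm_inf_inf X = Max (range (\<lambda>(i, j). \<bar>X $ i $ j\<bar>))"

definition gradient :: "(real^'n \<Rightarrow> real) \<Rightarrow> real^'n \<Rightarrow> real^'n"
  where "gradient g x = (THE D. GDERIV g x :> D)"

lemma gradient_eqI:
  assumes "GDERIV g x :> D"
  shows "gradient g x = D"
  unfolding gradient_def
proof (rule the_equality)
  show "GDERIV g x :> D" by (rule assms)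
next
  fix E assume "GDERIV g x :> E"
  with assms have "(\<lambda>h. h \<bullet> D) = (\<lambda>h. h \<bullet> E)"
    unfolding gderiv_def by (rule has_derivative_unique)
  then show "E = D"
    by (metis vector_eq_ldot)
qed

lemma GDERIV_gradient:
  assumes "g differentiable (at x)"
  shows "GDERIV g x :> gradient g x"
proof -
  obtain g' where g': "(g has_derivative g') (at x)"
    using assms unfolding differentiable_def by blast
  have "linear g'"
    using g' by (rule has_derivative_linear)
  then have "g' = (\<lambda>h. h \<bullet> adjoint g' 1)"
    by (simp add: adjoint_works fun_eq_iff)
  with g' have "GDERIV g x :> adjoint g' 1"
    unfolding gderiv_def by metis
  then show ?thesis
    using gradient_eqI by metis
qed

definition block_matrix ::
  "real^'n^'m \<Rightarrow> real^'q^'m \<Rightarrow> real^'n^'p \<Rightarrow> real^'q^'p \<Rightarrow> real^('n + 'q)^('m + 'p)"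
  where "block_matrix M11 M12 M21 M22 = (\<chi> i j.
    case i of
      Inl i1 \<Rightarrow> (case j of Inl j1 \<Rightarrow> M11 $ i1 $ j1 | Inr j2 \<Rightarrow> M12 $ i1 $ j2)
    | Inr i2 \<Rightarrow> (case j of Inl j1 \<Rightarrow> M21 $ i2 $ j1 | Inr j2 \<Rightarrow> M22 $ i2 $ j2))"

text \<open>Bochner integrals of non-integrable functions are \<open>0\<close> by convention, so the
  existence of the moments is part of the following two predicates.\<close>

definition has_mean_vector :: "(real^'n) measure \<Rightarrow> real^'n \<Rightarrow> bool"
  where "has_mean_vector p \<mu> \<longleftrightarrow>
    integrable p (\<lambda>\<zeta>. \<zeta>) \<and> integral\<^sup>L p (\<lambda>\<zeta>. \<zeta>) = \<mu>"

definition has_covariance_matrix :: "(real^'n) measure \<Rightarrow> real^'n^'n \<Rightarrow> bool"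
  where "has_covariance_matrix p S \<longleftrightarrow>
    (\<exists>\<mu>. has_mean_vector p \<mu> \<and>
      (\<forall>i j. integrable p (\<lambda>\<zeta>. (\<zeta> $ i - \<mu> $ i) * (\<zeta> $ j - \<mu> $ j)) \<and>
             integral\<^sup>L p (\<lambda>\<zeta>. (\<zeta> $ i - \<mu> $ i) * (\<zeta> $ j - \<mu> $ j)) = S $ i $ j))"

definition mean_uncertainty :: "real^'n \<Rightarrow> real^'m^'n \<Rightarrow> real \<Rightarrow> (real^'n) set"
  where "mean_uncertainty \<mu> A \<alpha> = {\<mu> + A *v z | z. infnorm z \<le> \<alpha>}"

definition cov_uncertainty :: "real^'n^'n \<Rightarrow> real^'k^'n \<Rightarrow> real \<Rightarrow> (real^'n^'n) set"
  where "cov_uncertainty S B \<beta> =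
    {S + B ** Z ** transpose B | Z. norm_inf_inf Z \<le> \<beta> \<and> Z \<in> symmetric_mats} \<inter> {Z. psd Z}"

definition ambiguity_set ::
  "(real^'n) set \<Rightarrow> (real^'n^'n) set \<Rightarrow> (real^'n) measure set"
  where "ambiguity_set U\<mu> US =
    {p. prob_space p \<and> sets p = sets borel \<and>
        (\<exists>\<mu>\<in>U\<mu>. has_mean_vector p \<mu>) \<and> (\<exists>S\<in>US. has_covariance_matrix p S)}"

end

theory Submission
  imports Defs
begin

text \<open>Write \<open>d\<close> for the gradient. By Cantelli's inequality and its two-point extremal law, the
  worst-case chance constraint over all laws with mean \<open>\<mu>\<close> and covariance \<open>S\<close> is
  \<open>g xt + d \<bullet> \<mu> + \<kappa> * sqrt (d \<bullet> (S *v d)) \<le> 0\<close>. Maximising over \<open>\<mu>\<close> gives the dual norm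
  \<open>\<alpha> * norm_1 (transpose A *v d)\<close>. The remaining condition bounds the linear functional
  \<open>d \<bullet> (S *v d)\<close> on the psd members of a compact convex set. As \<open>\<Sigma>t\<close> is a Slater point, a separating
  hyperplane yields a multiplier \<open>W\<close> that dominates \<open>d d\<^sup>T\<close> and certifies the bound; rescaling
  \<open>W\<close> and taking the matching \<open>z\<close> turns the squared bound into the one with the square root.\<close>

section \<open>Positive semidefinite matrices as sums of rank-one matrices\<close>

definition outer :: "real^'n \<Rightarrow> real^'n^'n"
  where "outer v = (\<chi> i j. v $ i * v $ j)"

lemma outer_0: "outer 0 = 0"
  by (simp add: outer_def vec_eq_iff)

lemma inner_outer: "M \<bullet> outer v = v \<bullet> (M *v v)"
  by (simp add: inner_vec_def outer_def matrix_vector_mult_def sum_distrib_left ac_simps)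

lemma outer_mult_vector: "outer v *v x = (v \<bullet> x) *\<^sub>R v"
  by (simp add: vec_eq_iff inner_vec_def outer_def matrix_vector_mult_def sum_distrib_left ac_simps)

lemma inner_outer_outer: "outer v \<bullet> outer x = (v \<bullet> x)\<^sup>2"
  by (simp add: inner_outer outer_mult_vector power2_eq_square inner_commute)

lemma outer_scaleR: "outer (c *\<^sub>R v) = c\<^sup>2 *\<^sub>R outer v"
  by (simp add: outer_def vec_eq_iff power2_eq_square)

lemma outer_symmetric: "outer v \<in> symmetric_mats"
  by (simp add: symmetric_mats_def outer_def transpose_def vec_eq_iff)

lemma sum_matrix_vector_mult:
  fixes F :: "'a \<Rightarrow> real^'n^'m"
  shows "(\<Sum>i\<in>I. F i) *v x = (\<Sum>i\<in>I. F i *v x)"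
  by (induction I rule: infinite_finite_induct) (auto simp: matrix_vector_mult_add_rdistrib)

lemma symmetric_inner_commute:
  assumes "R \<in> symmetric_mats"
  shows "v \<bullet> (R *v w) = w \<bullet> (R *v v)"
proof -
  have "v \<bullet> (R *v w) = (v v* R) \<bullet> w"
    by (simp add: dot_lmul_matrix)
  also have "v v* R = R *v v"
    using assms by (metis (mono_tags) mem_Collect_eq symmetric_mats_def transpose_matrix_vector)
  finally show ?thesis
    by (simp add: inner_commute)
qed

lemma symmetric_mats_subspace: "subspace symmetric_mats"
  by (auto simp: subspace_def symmetric_mats_def transpose_def vec_eq_iff)

lemma psd_iff_inner_outer: "psd Z \<longleftrightarrow> Z \<in> symmetric_mats \<and> (\<forall>v. Z \<bullet> outer v \<ge> 0)"
  by (simp add: psd_def inner_outer)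

lemma psd_expand:
  assumes "R \<in> symmetric_mats"
  shows "(v + t *\<^sub>R w) \<bullet> (R *v (v + t *\<^sub>R w)) =
         v \<bullet> (R *v v) + 2 * t * (v \<bullet> (R *v w)) + t\<^sup>2 * (w \<bullet> (R *v w))"
  using symmetric_inner_commute[OF assms, of w v]
  by (simp add: inner_simps matrix_vector_right_distrib matrix_vector_mult_scaleR
      power2_eq_square algebra_simps)

text \<open>A nonnegative form that vanishes at \<open>v\<close> is minimal there, so its derivative
  along \<open>w = R *v v\<close>, which is \<open>2 * (w \<bullet> w)\<close>, must vanish.\<close>

lemma psd_mult_eq_0:
  assumes "psd R" and "v \<bullet> (R *v v) = 0"
  shows "R *v v = 0"
proof -
  have sym: "R \<in> symmetric_mats" and pos: "\<And>x. x \<bullet> (R *v x) \<ge> 0"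
    using assms(1) by (auto simp: psd_def)
  define w where "w = R *v v"
  define c where "c = w \<bullet> (R *v w)"
  have "c \<ge> 0"
    by (simp add: c_def pos)
  have ineq: "2 * t * (w \<bullet> w) \<le> t\<^sup>2 * c" for t
  proof -
    have "0 \<le> (v + (-t) *\<^sub>R w) \<bullet> (R *v (v + (-t) *\<^sub>R w))"
      by (rule pos)
    also have "\<dots> = t\<^sup>2 * c - 2 * t * (v \<bullet> (R *v w))"
      using psd_expand[OF sym, of v "-t" w] assms(2) by (simp add: c_def)
    also have "v \<bullet> (R *v w) = w \<bullet> w"
      using symmetric_inner_commute[OF sym, of v w] by (simp add: w_def)
    finally show ?thesis by simp
  qed
  have "w \<bullet> w = 0"
  proof (rule ccontr)
    assume "w \<bullet> w \<noteq> 0"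
    then have p: "w \<bullet> w > 0" by simp
    \<comment> \<open>A step along \<open>-w\<close> short enough for the linear term to beat the
      quadratic one; the added \<open>1\<close> covers \<open>c = 0\<close>.\<close>
    define t where "t = (w \<bullet> w) / (c + 1)"
    have "t > 0" using p \<open>c \<ge> 0\<close> by (simp add: t_def)
    have "2 * t * (w \<bullet> w) \<le> t\<^sup>2 * c"
      by (rule ineq)
    then have "2 * (w \<bullet> w) \<le> t * c"
      using \<open>t > 0\<close> by (simp add: power2_eq_square)
    also have "\<dots> \<le> w \<bullet> w"
      using p \<open>c \<ge> 0\<close> by (simp add: t_def field_simps)
    finally show False using p by simp
  qed
  then show ?thesis by (simp add: w_def)
qed

text \<open>When \<open>e \<bullet> (R *v e) = 0\<close> the quotient is \<open>0\<close> and \<open>R *v e = 0\<close> already,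
  so no positivity hypothesis is needed.\<close>

lemma psd_schur:
  fixes R :: "real^'n^'n" and e :: "real^'n"
  assumes "psd R"
  defines "u \<equiv> inverse (sqrt (e \<bullet> (R *v e))) *\<^sub>R (R *v e)"
  shows "psd (R - outer u)" and "(R - outer u) *v e = 0"
    and "R *v x = 0 \<Longrightarrow> (R - outer u) *v x = 0"
proof -
  have sym: "R \<in> symmetric_mats" and pos: "\<And>x. x \<bullet> (R *v x) \<ge> 0"
    using assms(1) by (auto simp: psd_def)
  define a where "a = e \<bullet> (R *v e)"
  have a: "a \<ge> 0" using pos a_def by simp
  have u: "u = inverse (sqrt a) *\<^sub>R (R *v e)"
    by (simp add: u_def a_def)
  have outer_u: "outer u = inverse a *\<^sub>R outer (R *v e)"
    using a by (simp add: u outer_scaleR power_inverse)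
  show "psd (R - outer u)"
    unfolding psd_iff_inner_outer
  proof (intro conjI allI)
    show "R - outer u \<in> symmetric_mats"
      by (intro subspace_diff symmetric_mats_subspace sym outer_symmetric)
  next
    fix v
    define b where "b = v \<bullet> (R *v e)"
    have b: "(R *v e) \<bullet> v = b" by (simp add: b_def inner_commute)
    have eq: "(R - outer u) \<bullet> outer v = v \<bullet> (R *v v) - inverse a * b\<^sup>2"
      unfolding outer_u inner_diff_left inner_scaleR_left inner_outer_outer b
      by (simp add: inner_outer)
    show "0 \<le> (R - outer u) \<bullet> outer v"
    proof (cases "a = 0")
      case True
      then show ?thesis using eq pos by simp
    next
      case False
      \<comment> \<open>Completing the square: \<open>- b / a\<close> minimises the form on the line
        through \<open>v\<close> with direction \<open>e\<close>.\<close>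
      have "0 \<le> (v + (- b / a) *\<^sub>R e) \<bullet> (R *v (v + (- b / a) *\<^sub>R e))"
        by (rule pos)
      also have "\<dots> = v \<bullet> (R *v v) - inverse a * b\<^sup>2"
        unfolding psd_expand[OF sym] a_def[symmetric] b_def[symmetric]
        using False by (simp add: field_simps power2_eq_square)
      finally show ?thesis using eq by simp
    qed
  qed
  show "(R - outer u) *v e = 0"
  proof (cases "a = 0")
    case True
    then show ?thesis
      using psd_mult_eq_0[OF assms(1), of e] by (simp add: a_def u outer_0)
  next
    case False
    have "(R *v e) \<bullet> e = a" by (simp add: a_def inner_commute)
    then show ?thesis
      using False by (simp add: outer_u matrix_vector_mult_diff_rdistrib outer_mult_vector
          flip: scaleR_matrix_vector_assoc)
  qed
  show "(R - outer u) *v x = 0" if "R *v x = 0"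
  proof -
    have "(R *v e) \<bullet> x = e \<bullet> (R *v x)"
      using symmetric_inner_commute[OF sym, of e x] by (simp add: inner_commute)
    then show ?thesis
      using that by (simp add: outer_u matrix_vector_mult_diff_rdistrib outer_mult_vector
          flip: scaleR_matrix_vector_assoc)
  qed
qed

text \<open>Subtracting a Schur rank-one term puts one more basis vector into the kernel and removes
  none, so the count of basis vectors outside the kernel drops. The index set \<open>{..N}\<close>
  is never empty, which later permits a uniform law on it; the zero matrix is the single term
  \<open>outer 0\<close>.\<close>

lemma psd_eq_sum_outer:
  fixes R :: "real^'n^'n"
  assumes "psd R"
  obtains N :: nat and w where "R = (\<Sum>i\<le>N. outer (w i))"
proof -
  have "\<exists>(N::nat) w. R = (\<Sum>i\<le>N. outer (w i))"
    using assms
  proof (induction "card {j. R *v axis j 1 \<noteq> 0}" arbitrary: R rule: less_induct)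
    case less
    show ?case
    proof (cases "\<exists>j. R *v axis j 1 \<noteq> 0")
      case False
      then have "R = 0"
        by (simp add: matrix_vector_mult_basis column_def vec_eq_iff)
      then show ?thesis
        by (intro exI[of _ 0] exI[of _ "\<lambda>_. 0"]) (simp add: outer_0)
    next
      case True
      then obtain j where j: "R *v axis j 1 \<noteq> 0" by blast
      define u where
        "u = inverse (sqrt (axis j 1 \<bullet> (R *v axis j 1))) *\<^sub>R (R *v axis j 1)"
      note schur = psd_schur(1,2)[OF less.prems, of "axis j 1", folded u_def]
        psd_schur(3)[OF less.prems, of _ "axis j 1", folded u_def]
      have "{i. (R - outer u) *v axis i 1 \<noteq> 0} \<subset> {i. R *v axis i 1 \<noteq> 0}"
        using schur(2,3) j by blast
      then have "card {i. (R - outer u) *v axis i 1 \<noteq> 0} < card {i. R *v axis i 1 \<noteq> 0}"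
        by (intro psubset_card_mono) auto
      then obtain N :: nat and w where Nw: "R - outer u = (\<Sum>i\<le>N. outer (w i))"
        using less.hyps schur(1) by blast
      have "R = (\<Sum>i\<le>Suc N. outer ((w(Suc N := u)) i))"
        using Nw by (simp add: algebra_simps)
      then show ?thesis by blast
    qed
  qed
  then show ?thesis using that by blast
qed

lemma pos_def_imp_psd: "pos_def Z \<Longrightarrow> psd Z"
  unfolding psd_def pos_def_def by (metis inner_zero_left less_eq_real_def)

text \<open>Writing \<open>R\<close> as a sum of \<open>outer (w i)\<close> makes
  \<open>P \<bullet> R\<close> a sum of nonnegative terms, so \<open>P\<close> kills every
  \<open>w i\<close>. By symmetry the range of \<open>P\<close> is orthogonal to all
  \<open>w i\<close>, hence lies in the kernel of \<open>R\<close>, which is trivial.\<close>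

lemma inner_pos_def_eq_0:
  assumes "pos_def R" and "psd P" and "P \<bullet> R \<le> 0"
  shows "P = 0"
proof -
  have "psd R"
    using assms(1) by (rule pos_def_imp_psd)
  then obtain N :: nat and w where R: "R = (\<Sum>i\<le>N. outer (w i))"
    using psd_eq_sum_outer by blast
  have "(\<Sum>i\<le>N. w i \<bullet> (P *v w i)) \<le> 0"
    using assms(3) unfolding R inner_sum_right inner_outer .
  moreover have "\<And>i. w i \<bullet> (P *v w i) \<ge> 0"
    using assms(2) by (simp add: psd_def)
  ultimately have "\<forall>i\<in>{..N}. w i \<bullet> (P *v w i) = 0"
    by (metis (no_types, lifting) dual_order.antisym finite_atMost sum_nonneg sum_nonneg_eq_0_iff)
  then have Pw: "P *v w i = 0" if "i \<le> N" for i
    using psd_mult_eq_0[OF assms(2)] that by simp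
  have "P *v x = 0" for x
  proof -
    have "R *v (P *v x) = 0"
      unfolding R sum_matrix_vector_mult outer_mult_vector
    proof (intro sum.neutral ballI)
      fix i assume "i \<in> {..N}"
      have "w i \<bullet> (P *v x) = x \<bullet> (P *v w i)"
        using assms(2) by (intro symmetric_inner_commute) (simp add: psd_def)
      then show "(w i \<bullet> (P *v x)) *\<^sub>R w i = 0"
        using Pw \<open>i \<in> {..N}\<close> by simp
    qed
    then show ?thesis
      using assms(1) unfolding pos_def_def by (metis inner_zero_right less_irrefl)
  qed
  then show ?thesis
    by (metis matrix_eq matrix_vector_mult_0)
qed

section \<open>Semidefinite duality\<close>

text \<open>Used to read sign conditions and cone inequalities off a separating hyperplane, by
  moving along a ray.\<close>

lemma affine_bounded_imp_slope_nonpos: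
  fixes x y b :: real
  assumes "\<And>t. t \<ge> 0 \<Longrightarrow> x + t * y \<le> b"
  shows "y \<le> 0"
proof (rule ccontr)
  assume "\<not> y \<le> 0"
  then have "x + ((\<bar>b - x\<bar> + 1) / y) * y \<le> b"
    by (intro assms) auto
  then show False using \<open>\<not> y \<le> 0\<close> by simp
qed

text \<open>The Slater point \<open>\<Sigma>\<close> rules out a vertical separating hyperplane.\<close>

lemma psd_quadratic_form_duality:
  fixes E :: "(real^'n^'n) set" and d :: "real^'n"
  assumes E: "convex E" "E \<subseteq> symmetric_mats" and "\<Sigma> \<in> E" "pos_def \<Sigma>"
    and bound: "\<And>S. S \<in> E \<Longrightarrow> psd S \<Longrightarrow> d \<bullet> (S *v d) \<le> V"
  obtains W where "W \<in> symmetric_mats" and "\<And>v. (d \<bullet> v)\<^sup>2 \<le> v \<bullet> (W *v v)"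
    and "\<And>S. S \<in> E \<Longrightarrow> W \<bullet> S \<le> V"
proof -
  \<comment> \<open>\<open>C1\<close> is the hypograph of the form at \<open>d\<close> over matrices
    with nonnegative form, symmetric or not. A point of \<open>T\<close> with matrix component
    \<open>0\<close> has \<open>Q = S\<close>, so \<open>T\<close> meets the open ray
    \<open>U\<close> only if \<open>bound\<close> fails.\<close>
  define C1 :: "((real^'n^'n) \<times> real) set"
    where "C1 = {(Q, r). (\<forall>v. Q \<bullet> outer v \<ge> 0) \<and> r \<le> Q \<bullet> outer d}"
  define C2 :: "((real^'n^'n) \<times> real) set" where "C2 = E \<times> {0}"
  define T where "T = (\<Union>x\<in>C1. \<Union>y\<in>C2. {x - y})"
  define U :: "((real^'n^'n) \<times> real) set" where "U = {0} \<times> {V<..}"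
  have "convex C1"
    unfolding convex_def C1_def
    by (auto simp: inner_add_left intro!: add_nonneg_nonneg mult_nonneg_nonneg)
      (meson add_mono mult_left_mono)
  moreover have "convex C2"
    unfolding C2_def using E(1) by (intro convex_Times) auto
  ultimately have "convex T"
    unfolding T_def by (rule convex_differences)
  have "convex U"
    unfolding U_def by (intro convex_Times) auto
  have memT: "(Q - S, r) \<in> T"
    if "\<And>v. Q \<bullet> outer v \<ge> 0" "S \<in> E" "r \<le> Q \<bullet> outer d" for Q S r
  proof -
    have "(Q, r) \<in> C1" "(S, 0) \<in> C2" using that by (auto simp: C1_def C2_def)
    then show ?thesis unfolding T_def by force
  qed
  have "(0 - \<Sigma>, 0) \<in> T"
    using \<open>\<Sigma> \<in> E\<close> by (intro memT) auto
  then have "T \<noteq> {}" by blast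
  have "(0, V + 1) \<in> U" by (simp add: U_def)
  then have "U \<noteq> {}" by blast
  have "T \<inter> U = {}"
  proof (rule ccontr)
    assume "T \<inter> U \<noteq> {}"
    then obtain Q r where Q: "(Q, r) \<in> C1" "Q \<in> E" "r > V"
      unfolding T_def U_def C2_def by auto
    then have "psd Q"
      using E(2) by (auto simp: C1_def psd_iff_inner_outer)
    then show False
      using bound[of Q] Q by (auto simp: C1_def inner_outer)
  qed
  then obtain a b where "a \<noteq> 0" and aT: "\<forall>x\<in>T. a \<bullet> x \<le> b" and aU: "\<forall>x\<in>U. a \<bullet> x \<ge> b"
    using separating_hyperplane_sets[OF \<open>convex T\<close> \<open>convex U\<close> \<open>T \<noteq> {}\<close> \<open>U \<noteq> {}\<close>] by blast
  obtain Y \<tau> where a: "a = (Y, \<tau>)" by force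
  have upper: "b \<le> \<tau> * r" if "r > V" for r
    using aU that by (auto simp: a U_def)
  have lower: "Y \<bullet> (Q - S) + \<tau> * r \<le> b"
    if "\<And>v. Q \<bullet> outer v \<ge> 0" "S \<in> E" "r \<le> Q \<bullet> outer d" for Q S r
    using aT memT[OF that] by (auto simp: a)
  \<comment> \<open>The ray \<open>U\<close> is unbounded upwards, which fixes the sign of
    \<open>\<tau>\<close>.\<close>
  have "-\<tau> \<le> 0"
  proof (rule affine_bounded_imp_slope_nonpos)
    fix t :: real assume "t \<ge> 0"
    then show "- \<tau> * (V + 1) + t * (- \<tau>) \<le> - b"
      using upper[of "V + 1 + t"] by (simp add: algebra_simps)
  qed
  \<comment> \<open>The endpoint \<open>V\<close> is not on the open ray and is approached from
    above; dividing by \<open>\<tau> + 1\<close> stays safe for \<open>\<tau> = 0\<close>.\<close>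
  have bV: "b \<le> \<tau> * V"
  proof (rule field_le_epsilon)
    fix e :: real assume "e > 0"
    have "b \<le> \<tau> * (V + e / (\<tau> + 1))"
      using \<open>e > 0\<close> \<open>-\<tau> \<le> 0\<close> by (intro upper) auto
    also have "\<dots> \<le> \<tau> * V + e"
      using \<open>e > 0\<close> \<open>-\<tau> \<le> 0\<close> by (simp add: field_simps)
    finally show "b \<le> \<tau> * V + e" .
  qed
  \<comment> \<open>Scaling \<open>Q\<close> inside the cone with \<open>S = \<Sigma>\<close> held
    fixed makes the inequality homogeneous.\<close>
  have cone: "Y \<bullet> Q + \<tau> * (Q \<bullet> outer d) \<le> 0" if "\<And>v. Q \<bullet> outer v \<ge> 0" for Q
  proof (rule affine_bounded_imp_slope_nonpos)
    fix t :: real assume "t \<ge> 0"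
    then show "- (Y \<bullet> \<Sigma>) + t * (Y \<bullet> Q + \<tau> * (Q \<bullet> outer d)) \<le> b"
      using lower[of "t *\<^sub>R Q" \<Sigma> "t * (Q \<bullet> outer d)"] that \<open>\<Sigma> \<in> E\<close>
      by (simp add: inner_simps algebra_simps)
  qed
  have YE: "- (Y \<bullet> S) \<le> \<tau> * V" if "S \<in> E" for S
    using lower[of 0 S 0] that bV by (simp add: inner_simps)
  have tr: "transpose M \<bullet> transpose N = M \<bullet> N" for M N :: "real^'n^'n"
    unfolding inner_vec_def transpose_def by (simp, subst sum.swap, rule refl)
  \<comment> \<open>Symmetry of \<open>Y\<close> comes from the nonsymmetric members of the cone:
    the skew matrix \<open>H\<close> has zero quadratic form, so \<open>cone\<close> applies to it
    and forces \<open>H \<bullet> H \<le> 0\<close>.\<close>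
  define H where "H = Y - transpose Y"
  have H: "transpose H = - H"
    by (simp add: H_def transpose_def vec_eq_iff)
  have Hv: "H \<bullet> outer v = 0" for v
  proof -
    have "H \<bullet> outer v = transpose H \<bullet> transpose (outer v)"
      by (simp add: tr)
    also have "\<dots> = - (H \<bullet> outer v)"
      using outer_symmetric[of v] by (simp add: H symmetric_mats_def)
    finally show ?thesis by simp
  qed
  have "Y \<bullet> H \<le> 0"
    using cone[of H] by (simp add: Hv)
  moreover have "transpose Y \<bullet> H = - (Y \<bullet> H)"
    using tr[of "transpose Y" H] by (simp add: H)
  ultimately have "H \<bullet> H \<le> 0"
    by (simp add: H_def inner_diff_left)
  then have "H = 0" by (metis inner_ge_zero inner_eq_zero_iff order_antisym)
  then have Ysym: "- Y \<in> symmetric_mats"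
    by (simp add: H_def symmetric_mats_def transpose_def vec_eq_iff)
  have dom: "\<tau> * (d \<bullet> v)\<^sup>2 \<le> - (Y \<bullet> outer v)" for v
    using cone[of "outer v"] by (simp add: inner_outer_outer inner_commute)
  \<comment> \<open>A vertical hyperplane would make \<open>- Y\<close> psd with nonpositive product
    against the positive definite \<open>\<Sigma>\<close>, hence \<open>Y = 0\<close>, contradicting
    \<open>a \<noteq> 0\<close>.\<close>
  have "\<tau> \<noteq> 0"
  proof
    assume "\<tau> = 0"
    then have "psd (- Y)"
      using Ysym dom by (simp add: psd_iff_inner_outer)
    moreover have "(- Y) \<bullet> \<Sigma> \<le> 0"
      using YE[OF \<open>\<Sigma> \<in> E\<close>] \<open>\<tau> = 0\<close> by simp
    ultimately have "Y = 0"
      using inner_pos_def_eq_0[OF \<open>pos_def \<Sigma>\<close>, of "- Y"] by simp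
    then show False
      using \<open>a \<noteq> 0\<close> \<open>\<tau> = 0\<close> a by (simp add: zero_prod_def)
  qed
  then have "\<tau> > 0" using \<open>-\<tau> \<le> 0\<close> by simp
  \<comment> \<open>The multiplier is \<open>- Y\<close> divided by \<open>\<tau>\<close>:
    \<open>dom\<close> gives domination of the rank-one form, \<open>YE\<close> the bound on
    \<open>E\<close>.\<close>
  show ?thesis
  proof
    show "inverse \<tau> *\<^sub>R (- Y) \<in> symmetric_mats"
      using Ysym symmetric_mats_subspace by (rule subspace_scale[rotated])
    show "(d \<bullet> v)\<^sup>2 \<le> v \<bullet> ((inverse \<tau> *\<^sub>R (- Y)) *v v)" for v
      using dom[of v] \<open>\<tau> > 0\<close> unfolding inner_outer[symmetric] by (simp add: field_simps)
    show "(inverse \<tau> *\<^sub>R (- Y)) \<bullet> S \<le> V" if "S \<in> E" for S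
      using YE[OF that] \<open>\<tau> > 0\<close> by (simp add: field_simps)
  qed
qed

section \<open>Moment problems with a linear chance constraint\<close>

text \<open>Grouping the two outcomes of the sign coin lets terms odd in the sign cancel inside the
  sum. The general codomain serves both the vector mean and the real covariance entries.\<close>

lemma expectation_two_coins_uniform:
  fixes h :: "bool \<times> bool \<times> nat \<Rightarrow> 'b::{banach, second_countable_topology}"
  assumes "0 \<le> q" "q \<le> 1"
  shows "measure_pmf.expectation
      (pair_pmf (bernoulli_pmf q) (pair_pmf (bernoulli_pmf (1/2)) (pmf_of_set {..N}))) h
    = (q / (2 * (real N + 1))) *\<^sub>R (\<Sum>i\<le>N. h (True, True, i) + h (True, False, i))
    + ((1 - q) / (2 * (real N + 1))) *\<^sub>R (\<Sum>i\<le>N. h (False, True, i) + h (False, False, i))"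
proof -
  let ?M = "pair_pmf (bernoulli_pmf q) (pair_pmf (bernoulli_pmf (1/2)) (pmf_of_set {..N}))"
  have "measure_pmf.expectation ?M h = (\<Sum>a\<in>UNIV \<times> UNIV \<times> {..N}. pmf ?M a *\<^sub>R h a)"
    by (rule integral_measure_pmf) auto
  also have "\<dots> = (\<Sum>b\<in>UNIV. \<Sum>s\<in>UNIV. \<Sum>i\<le>N. pmf ?M (b, s, i) *\<^sub>R h (b, s, i))"
    by (simp add: sum.cartesian_product')
  also have "\<dots> = (\<Sum>b\<in>UNIV. \<Sum>s\<in>UNIV. \<Sum>i\<le>N.
      ((if b then q else 1 - q) / (2 * (real N + 1))) *\<^sub>R h (b, s, i))"
    using assms by (intro sum.cong refl) (auto simp: pmf_pair add.commute)
  finally show ?thesis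
    by (simp add: UNIV_bool sum.distrib scaleR_add_right flip: scaleR_right.sum)
qed

text \<open>The mean-zero, unit-variance two-point law on \<open>k\<close> and \<open>- 1 / k\<close> attains equality in
  Cantelli's inequality; it drives \<open>v\<close>, while the remaining covariance is produced by
  \<open>\<plusminus>\<surd>(N + 1) w i\<close> with uniform index \<open>i\<close> and sign.\<close>

lemma two_point_distribution_exists:
  fixes v \<mu> d :: "real^'n" and w :: "nat \<Rightarrow> real^'n" and k :: real
  assumes k: "k > 0" and orth: "\<And>i. i \<le> N \<Longrightarrow> d \<bullet> w i = 0"
  obtains p where "prob_space p" "sets p = sets borel" "has_mean_vector p \<mu>"
    "has_covariance_matrix p (outer v + (\<Sum>i\<le>N. outer (w i)))"
    "measure p {\<zeta>. d \<bullet> \<mu> + k * (d \<bullet> v) \<le> d \<bullet> \<zeta>} \<ge> 1 / (1 + k\<^sup>2)"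
proof -
  define q where "q = 1 / (1 + k\<^sup>2)"
  have q: "0 \<le> q" "q \<le> 1" by (simp_all add: q_def divide_le_eq add_pos_nonneg)
  have k2: "1 + k\<^sup>2 \<noteq> 0" using zero_le_power2[of k] by linarith
  have q': "1 - q = q * k\<^sup>2"
    using k2 by (simp add: q_def field_simps)
  \<comment> \<open>\<open>q1\<close> and \<open>q2\<close> express mean zero and unit variance of
    the law with mass \<open>q\<close> at \<open>k\<close> and \<open>1 - q\<close> at
    \<open>- 1 / k\<close>.\<close>
  have q1: "q * k - (1 - q) / k = 0"
    using k by (simp add: q' power2_eq_square)
  have q2: "q * k\<^sup>2 + (1 - q) / k\<^sup>2 = 1"
    using k q' by simp
  \<comment> \<open>The square of \<open>r\<close> offsets the weight \<open>1 / (N + 1)\<close> of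
    each index in the covariance.\<close>
  define r where "r = sqrt (real N + 1)"
  have r: "r * r = real N + 1" by (simp add: r_def)
  define M where
    "M = pair_pmf (bernoulli_pmf q) (pair_pmf (bernoulli_pmf (1/2)) (pmf_of_set {..N}))"
  note E = expectation_two_coins_uniform[OF q, of N, folded M_def]
  define f :: "bool \<times> bool \<times> nat \<Rightarrow> real^'n" where "f = (\<lambda>(b, s, i).
    \<mu> + (if b then k else - 1 / k) *\<^sub>R v + (if s then r else - r) *\<^sub>R w i)"
  have fin: "finite (set_pmf M)"
    by (auto simp: M_def)
  have [measurable]: "f \<in> measurable (measure_pmf M) borel"
    by simp
  define p where "p = distr (measure_pmf M) borel f"
  have mean: "has_mean_vector p \<mu>"
    unfolding has_mean_vector_def
  proof
    show "integrable p (\<lambda>\<zeta>. \<zeta>)"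
      unfolding p_def by (simp add: integrable_distr_eq integrable_measure_pmf_finite[OF fin])
    have avg: "(a / (2 * (real N + 1))) *\<^sub>R (\<Sum>i\<le>N. 2 *\<^sub>R x) = a *\<^sub>R x"
      for a and x :: "real^'n"
    proof -
      have "a / (2 * (real N + 1)) * (real (card {..N}) * 2) = a"
        by (simp add: field_simps)
      then show ?thesis
        by (simp only: sum_constant_scaleR scaleR_scaleR mult.assoc)
    qed
    have "integral\<^sup>L p (\<lambda>\<zeta>. \<zeta>) = measure_pmf.expectation M f"
      unfolding p_def by (simp add: integral_distr)
    also have "\<dots> = (q / (2 * (real N + 1))) *\<^sub>R (\<Sum>i\<le>N. 2 *\<^sub>R (\<mu> + k *\<^sub>R v))
      + ((1 - q) / (2 * (real N + 1))) *\<^sub>R (\<Sum>i\<le>N. 2 *\<^sub>R (\<mu> - (1 / k) *\<^sub>R v))"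
      unfolding E f_def
      by (intro arg_cong2[of _ _ _ _ "(+)"] arg_cong2[of _ _ _ _ "(*\<^sub>R)"] refl sum.cong)
        (simp_all add: vec_eq_iff algebra_simps)
    also have "\<dots> = q *\<^sub>R (\<mu> + k *\<^sub>R v) + (1 - q) *\<^sub>R (\<mu> - (1 / k) *\<^sub>R v)"
      unfolding avg ..
    also have "\<dots> = \<mu> + (q * k - (1 - q) / k) *\<^sub>R v"
      by (simp add: algebra_simps diff_divide_distrib)
    finally show "integral\<^sup>L p (\<lambda>\<zeta>. \<zeta>) = \<mu>"
      by (simp add: q1)
  qed
  have cov: "integrable p (\<lambda>\<zeta>. (\<zeta> $ i - \<mu> $ i) * (\<zeta> $ j - \<mu> $ j)) \<and>
      integral\<^sup>L p (\<lambda>\<zeta>. (\<zeta> $ i - \<mu> $ i) * (\<zeta> $ j - \<mu> $ j)) =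
      (outer v + (\<Sum>i\<le>N. outer (w i))) $ i $ j" for i j
  proof
    show "integrable p (\<lambda>\<zeta>. (\<zeta> $ i - \<mu> $ i) * (\<zeta> $ j - \<mu> $ j))"
      unfolding p_def by (simp add: integrable_distr_eq integrable_measure_pmf_finite[OF fin])
    define W where "W = (\<Sum>l\<le>N. w l $ i * w l $ j)"
    have avg: "a / (2 * (real N + 1)) * (2 * (real N + 1) * x) = a * x" for a x
      by (simp add: field_simps)
    have sq: "(\<Sum>l\<le>N. 2 * (a + (real N + 1) * (w l $ i * w l $ j)))
        = 2 * (real N + 1) * (a + W)" for a
    proof -
      have "(\<Sum>l\<le>N. 2 * (a + (real N + 1) * (w l $ i * w l $ j)))
          = (real N + 1) * (2 * a) + 2 * ((real N + 1) * W)"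
        by (simp add: W_def sum.distrib distrib_left add.commute flip: sum_distrib_left)
      then show ?thesis by (simp add: algebra_simps)
    qed
    have "integral\<^sup>L p (\<lambda>\<zeta>. (\<zeta> $ i - \<mu> $ i) * (\<zeta> $ j - \<mu> $ j))
        = measure_pmf.expectation M (\<lambda>x. (f x $ i - \<mu> $ i) * (f x $ j - \<mu> $ j))"
      unfolding p_def by (simp add: integral_distr)
    \<comment> \<open>Products of a \<open>v\<close> entry with a \<open>w\<close> entry are odd in
      the sign and cancel in pairs.\<close>
    also have "\<dots> =
        (q / (2 * (real N + 1))) * (\<Sum>l\<le>N. 2 * (k\<^sup>2 * (v $ i * v $ j) + r * r * (w l $ i * w l $ j)))
      + ((1 - q) / (2 * (real N + 1)))
        * (\<Sum>l\<le>N. 2 * (1 / k\<^sup>2 * (v $ i * v $ j) + r * r * (w l $ i * w l $ j)))"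
      unfolding E f_def real_scaleR_def
      by (intro arg_cong2[of _ _ _ _ "(+)"] arg_cong2[of _ _ _ _ "(*)"] refl sum.cong)
        (simp_all add: algebra_simps power2_eq_square)
    also have "\<dots> = q * (k\<^sup>2 * (v $ i * v $ j) + W) + (1 - q) * (1 / k\<^sup>2 * (v $ i * v $ j) + W)"
      unfolding r sq avg ..
    also have "\<dots> = (q * k\<^sup>2 + (1 - q) / k\<^sup>2) * (v $ i * v $ j) + W"
      by (simp add: algebra_simps diff_divide_distrib)
    finally show "integral\<^sup>L p (\<lambda>\<zeta>. (\<zeta> $ i - \<mu> $ i) * (\<zeta> $ j - \<mu> $ j)) =
        (outer v + (\<Sum>i\<le>N. outer (w i))) $ i $ j"
      by (simp add: q2 outer_def W_def)
  qed
  \<comment> \<open>When the first coin shows \<open>True\<close>, the point satisfies \<open>d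
    \<bullet> \<zeta> = d \<bullet> \<mu> + k * (d \<bullet> v)\<close>, since \<open>orth\<close>
    hides the \<open>w\<close> terms from \<open>d\<close>.\<close>
  have "q = measure (bernoulli_pmf q) {True}"
    using q by (simp add: measure_pmf_single)
  also have "\<dots> = measure (map_pmf fst M) {True}"
    by (simp only: M_def map_fst_pair_pmf)
  also have "\<dots> = measure M {x. fst x}"
    by (simp add: vimage_def)
  also have "\<dots> \<le> measure M (f -` {\<zeta>. d \<bullet> \<mu> + k * (d \<bullet> v) \<le> d \<bullet> \<zeta>})"
    by (intro measure_pmf.finite_measure_mono_AE)
      (auto simp: AE_measure_pmf_iff M_def f_def inner_simps orth)
  also have "\<dots> = measure p {\<zeta>. d \<bullet> \<mu> + k * (d \<bullet> v) \<le> d \<bullet> \<zeta>}"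
    unfolding p_def by (subst measure_distr) auto
  finally have "1 / (1 + k\<^sup>2) \<le> measure p {\<zeta>. d \<bullet> \<mu> + k * (d \<bullet> v) \<le> d \<bullet> \<zeta>}"
    by (simp add: q_def)
  moreover have "prob_space p"
    unfolding p_def by (intro measure_pmf.prob_space_distr) simp
  moreover have "sets p = sets borel"
    by (simp add: p_def)
  ultimately show ?thesis
    using that mean cov unfolding has_covariance_matrix_def by blast
qed

text \<open>The Schur term of \<open>S\<close> at \<open>d\<close> carries all variance in direction
  \<open>d\<close>. The remainder annihilates \<open>d\<close>, so every vector in its rank-one
  decomposition is orthogonal to \<open>d\<close>, as the two-point construction requires.\<close>

lemma worst_case_distribution_exists:
  fixes S :: "real^'n^'n" and \<mu> d :: "real^'n" and k :: real
  assumes "psd S" and "k > 0"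
  obtains p where "prob_space p" "sets p = sets borel" "has_mean_vector p \<mu>"
    "has_covariance_matrix p S"
    "measure p {\<zeta>. d \<bullet> \<mu> + k * sqrt (d \<bullet> (S *v d)) \<le> d \<bullet> \<zeta>} \<ge> 1 / (1 + k\<^sup>2)"
proof -
  have d: "d \<bullet> (S *v d) \<ge> 0"
    using assms(1) by (simp add: psd_def)
  define v where "v = inverse (sqrt (d \<bullet> (S *v d))) *\<^sub>R (S *v d)"
  note schur = psd_schur(1,2)[OF assms(1), of d, folded v_def]
  obtain N :: nat and w where w: "S - outer v = (\<Sum>i\<le>N. outer (w i))"
    using psd_eq_sum_outer[OF schur(1)] .
  have "(\<Sum>i\<le>N. (d \<bullet> w i)\<^sup>2) = (S - outer v) \<bullet> outer d"
    unfolding w inner_sum_left inner_outer_outer by (simp add: inner_commute)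
  also have "\<dots> = 0"
    using schur(2) by (simp add: inner_outer)
  finally have orth: "d \<bullet> w i = 0" if "i \<le> N" for i
    using that by (simp add: sum_nonneg_eq_0_iff)
  have dv: "d \<bullet> v = sqrt (d \<bullet> (S *v d))"
    using d by (simp add: v_def real_div_sqrt field_simps)
  show ?thesis
    using two_point_distribution_exists[where N=N and w=w and \<mu>=\<mu> and v=v, OF assms(2) orth] that
    unfolding w[symmetric] dv by auto
qed

section \<open>One-sided tail bounds and the exact worst-case chance constraint\<close>

text \<open>Markov's inequality for \<open>(Y + a)\<^sup>2\<close> gives the bound
  \<open>(s + a\<^sup>2) / (t + a)\<^sup>2\<close>; the shift \<open>a = s / t\<close> minimises
  it.\<close>

lemma (in prob_space) cantelli:
  fixes Y :: "'a \<Rightarrow> real"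
  assumes [measurable]: "integrable M Y" and sq: "integrable M (\<lambda>x. (Y x)\<^sup>2)"
    and "expectation Y = 0" and "t > 0"
  defines "s \<equiv> expectation (\<lambda>x. (Y x)\<^sup>2)"
  shows "prob {x \<in> space M. Y x > t} \<le> s / (s + t\<^sup>2)"
proof -
  have "s \<ge> 0" unfolding s_def by (rule Bochner_Integration.integral_nonneg) simp
  define a where "a = s / t"
  have "a \<ge> 0" using \<open>s \<ge> 0\<close> \<open>t > 0\<close> by (simp add: a_def)
  define u where "u = (\<lambda>x. (Y x + a)\<^sup>2)"
  have u: "u = (\<lambda>x. (Y x)\<^sup>2 + 2 * a * Y x + a\<^sup>2)"
    by (auto simp: u_def power2_eq_square algebra_simps)
  have int: "integrable M u"
    unfolding u using assms(1) sq by auto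
  have Eu: "expectation u = s + a\<^sup>2"
    unfolding u using assms(1,3) sq by (simp add: s_def prob_space)
  have "prob {x \<in> space M. Y x > t} \<le> prob {x \<in> space M. u x \<ge> (t + a)\<^sup>2}"
    using \<open>a \<ge> 0\<close> \<open>t > 0\<close> int
    by (intro finite_measure_mono) (auto simp: u_def intro!: power_mono)
  also have "\<dots> \<le> expectation u / (t + a)\<^sup>2"
    using \<open>a \<ge> 0\<close> \<open>t > 0\<close>
    by (intro integral_Markov_inequality_measure[OF int sets.empty_sets]) (auto simp: u_def)
  also have "\<dots> = s / (s + t\<^sup>2)"
  proof -
    have "s + t\<^sup>2 > 0" using \<open>s \<ge> 0\<close> \<open>t > 0\<close> by (simp add: add_nonneg_pos)
    have "t + a = (s + t\<^sup>2) / t" "s + a\<^sup>2 = s * (s + t\<^sup>2) / t\<^sup>2"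
      using \<open>t > 0\<close> by (simp_all add: a_def field_simps power2_eq_square)
    then show ?thesis
      using \<open>s + t\<^sup>2 > 0\<close> \<open>t > 0\<close> unfolding Eu
      by (simp add: power_divide power2_eq_square[of "s + t\<^sup>2"])
  qed
  finally show ?thesis .
qed

lemma
  assumes mean: "has_mean_vector p \<mu>" and cov: "has_covariance_matrix p S"
  shows integrable_inner_centered_sq: "integrable p (\<lambda>\<zeta>. (d \<bullet> (\<zeta> - \<mu>))\<^sup>2)"
    and integral_inner_centered_sq: "(\<integral>\<zeta>. (d \<bullet> (\<zeta> - \<mu>))\<^sup>2 \<partial>p) = d \<bullet> (S *v d)"
proof -
  \<comment> \<open>\<open>has_covariance_matrix\<close> brings its own mean; both means equal the
    integral of the identity and so coincide.\<close>
  have int: "integrable p (\<lambda>\<zeta>. (\<zeta> $ i - \<mu> $ i) * (\<zeta> $ j - \<mu> $ j))"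
    and val: "(\<integral>\<zeta>. (\<zeta> $ i - \<mu> $ i) * (\<zeta> $ j - \<mu> $ j) \<partial>p) = S $ i $ j" for i j
    using mean cov by (auto simp: has_covariance_matrix_def has_mean_vector_def)
  have eq: "(d \<bullet> (\<zeta> - \<mu>))\<^sup>2 =
      (\<Sum>i\<in>UNIV. \<Sum>j\<in>UNIV. (d $ i * d $ j) * ((\<zeta> $ i - \<mu> $ i) * (\<zeta> $ j - \<mu> $ j)))" for \<zeta>
    unfolding power2_eq_square inner_vec_def sum_product
    by (intro sum.cong refl) (simp add: ac_simps)
  show "integrable p (\<lambda>\<zeta>. (d \<bullet> (\<zeta> - \<mu>))\<^sup>2)"
    unfolding eq using int by auto
  have "(\<integral>\<zeta>. (d \<bullet> (\<zeta> - \<mu>))\<^sup>2 \<partial>p) = (\<Sum>i\<in>UNIV. \<Sum>j\<in>UNIV. (d $ i * d $ j) * S $ i $ j)"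
    unfolding eq using int by (simp add: Bochner_Integration.integral_sum val)
  also have "\<dots> = d \<bullet> (S *v d)"
    by (simp add: inner_vec_def matrix_vector_mult_def sum_distrib_left ac_simps)
  finally show "(\<integral>\<zeta>. (d \<bullet> (\<zeta> - \<mu>))\<^sup>2 \<partial>p) = d \<bullet> (S *v d)" .
qed

text \<open>With slack \<open>t\<close> and variance \<open>s\<close>, the condition
  \<open>t \<ge> \<kappa> * sqrt s\<close> is what brings Cantelli's bound down to
  \<open>\<epsilon>\<close>.\<close>

lemma chance_constraint_of_moments:
  fixes \<epsilon> \<kappa> c :: real
  assumes "prob_space p" and sets_p: "sets p = sets borel"
    and mean: "has_mean_vector p \<mu>" and cov: "has_covariance_matrix p S"
    and \<epsilon>: "0 < \<epsilon>" "\<epsilon> < 1" and \<kappa>: "\<kappa> = sqrt ((1 - \<epsilon>) / \<epsilon>)"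
    and le: "c + d \<bullet> \<mu> + \<kappa> * sqrt (d \<bullet> (S *v d)) \<le> 0"
  shows "measure p {\<zeta>. c + d \<bullet> \<zeta> \<le> 0} \<ge> 1 - \<epsilon>"
proof -
  interpret prob_space p by fact
  have [measurable_cong]: "sets p = sets borel" by fact
  have sp: "space p = UNIV" using sets_eq_imp_space_eq[OF sets_p] by simp
  define Y where "Y = (\<lambda>\<zeta>. d \<bullet> (\<zeta> - \<mu>))"
  define s where "s = d \<bullet> (S *v d)"
  define t where "t = - (c + d \<bullet> \<mu>)"
  have \<mu>: "integrable p (\<lambda>\<zeta>. \<zeta>)" "expectation (\<lambda>\<zeta>. \<zeta>) = \<mu>"
    using mean by (auto simp: has_mean_vector_def)
  have Y: "integrable p Y" "expectation Y = 0"
    unfolding Y_def using \<mu> by (simp_all add: prob_space)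
  have Y2: "integrable p (\<lambda>\<zeta>. (Y \<zeta>)\<^sup>2)" "expectation (\<lambda>\<zeta>. (Y \<zeta>)\<^sup>2) = s"
    unfolding Y_def s_def
    using integrable_inner_centered_sq[OF mean cov] integral_inner_centered_sq[OF mean cov] by auto
  have s: "s \<ge> 0"
    unfolding Y2(2)[symmetric] by (rule Bochner_Integration.integral_nonneg) simp
  have t: "t \<ge> \<kappa> * sqrt s"
    using le by (simp add: t_def s_def)
  have \<kappa>0: "\<kappa> > 0" and \<kappa>2: "\<kappa>\<^sup>2 = (1 - \<epsilon>) / \<epsilon>" using \<epsilon> by (auto simp: \<kappa>)
  have "prob {\<zeta> \<in> space p. Y \<zeta> > t} \<le> \<epsilon>"
  proof (cases "t > 0")
    case True
    have "s * \<kappa>\<^sup>2 = (\<kappa> * sqrt s)\<^sup>2"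
      using s by (simp add: power_mult_distrib)
    also have "\<dots> \<le> t\<^sup>2"
      using t \<kappa>0 s by (intro power_mono) auto
    finally have "s * (1 - \<epsilon>) \<le> \<epsilon> * t\<^sup>2"
      using \<epsilon> by (simp add: \<kappa>2 field_simps)
    moreover have "s + t\<^sup>2 > 0"
      using s True by (simp add: add_nonneg_pos)
    ultimately have "s / (s + t\<^sup>2) \<le> \<epsilon>"
      by (simp add: pos_divide_le_eq algebra_simps)
    then show ?thesis
      using cantelli[OF Y(1) Y2(1) Y(2) True] by (simp add: Y2(2))
  next
    \<comment> \<open>Cantelli needs \<open>t > 0\<close>. Here \<open>t\<close> and
      \<open>s\<close> are forced to be \<open>0\<close>, so \<open>Y\<close> vanishes almost
      everywhere.\<close>
    case False
    have "\<kappa> * sqrt s \<ge> 0" using \<kappa>0 s by simp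
    then have "t = 0" "\<kappa> * sqrt s = 0" using t False by linarith+
    then have "s = 0" using \<kappa>0 by simp
    then have "AE \<zeta> in p. (Y \<zeta>)\<^sup>2 = 0"
      using integral_nonneg_eq_0_iff_AE[OF Y2(1)] Y2(2) by simp
    then have "AE \<zeta> in p. \<not> Y \<zeta> > t"
      by eventually_elim (simp add: \<open>t = 0\<close>)
    then have "prob {\<zeta> \<in> space p. Y \<zeta> > t} = 0"
      using Y(1) by (subst prob_eq_0) auto
    then show ?thesis using \<epsilon> by simp
  qed
  also have "{\<zeta> \<in> space p. Y \<zeta> > t} = space p - {\<zeta>. c + d \<bullet> \<zeta> \<le> 0}"
    by (auto simp: Y_def t_def sp inner_simps)
  also have "prob (space p - {\<zeta>. c + d \<bullet> \<zeta> \<le> 0}) = 1 - prob {\<zeta>. c + d \<bullet> \<zeta> \<le> 0}"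
    by (rule prob_compl) (simp add: sets_p)
  finally show ?thesis by simp
qed

text \<open>Sufficiency is the Cantelli bound. For necessity, a violated moment condition is
  attacked with two-point laws for \<open>k < \<kappa>\<close>, whose bad event has mass above
  \<open>\<epsilon>\<close> because \<open>1 + \<kappa>\<^sup>2 = 1 / \<epsilon>\<close>.\<close>

lemma robust_chance_constraint_iff:
  fixes \<epsilon> \<kappa> c :: real and d :: "real^'n"
  assumes \<epsilon>: "0 < \<epsilon>" "\<epsilon> < 1" and \<kappa>: "\<kappa> = sqrt ((1 - \<epsilon>) / \<epsilon>)"
    and ne: "U\<mu> \<noteq> {}" "US \<noteq> {}" and psd: "\<And>S. S \<in> US \<Longrightarrow> psd S"
  shows "(INF p \<in> ambiguity_set U\<mu> US. measure p {\<zeta>. c + d \<bullet> \<zeta> \<le> 0}) \<ge> 1 - \<epsilon> \<longleftrightarrow>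
    (\<forall>\<mu>\<in>U\<mu>. \<forall>S\<in>US. c + d \<bullet> \<mu> + \<kappa> * sqrt (d \<bullet> (S *v d)) \<le> 0)"
    (is "?I \<ge> _ \<longleftrightarrow> ?R")
proof
  have \<kappa>0: "\<kappa> > 0" and \<kappa>2: "\<kappa>\<^sup>2 = (1 - \<epsilon>) / \<epsilon>" using \<epsilon> by (auto simp: \<kappa>)
  assume I: "?I \<ge> 1 - \<epsilon>"
  show ?R
  proof (intro ballI)
    fix \<mu> S assume "\<mu> \<in> U\<mu>" "S \<in> US"
    \<comment> \<open>At \<open>k = \<kappa>\<close> the bad event is only known to have mass at
      least \<open>\<epsilon>\<close>, which is no contradiction; hence the factor
      \<open>z < 1\<close>, which is then sent to \<open>1\<close>.\<close>
    have "z * (\<kappa> * sqrt (d \<bullet> (S *v d))) \<le> - (c + d \<bullet> \<mu>)" if z: "0 < z" "z < 1" for z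
    proof (rule ccontr)
      define k where "k = z * \<kappa>"
      have k: "0 < k" "k < \<kappa>" using z \<kappa>0 by (auto simp: k_def)
      assume "\<not> ?thesis"
      then have gt: "c + d \<bullet> \<mu> + k * sqrt (d \<bullet> (S *v d)) > 0"
        by (simp add: k_def mult.assoc)
      obtain p where p: "prob_space p" "sets p = sets borel" "has_mean_vector p \<mu>"
        "has_covariance_matrix p S"
        "measure p {\<zeta>. d \<bullet> \<mu> + k * sqrt (d \<bullet> (S *v d)) \<le> d \<bullet> \<zeta>} \<ge> 1 / (1 + k\<^sup>2)"
        using worst_case_distribution_exists[OF psd[OF \<open>S \<in> US\<close>] k(1)] .
      interpret prob_space p by fact
      have sp: "space p = UNIV" using sets_eq_imp_space_eq[OF p(2)] by simp
      have "k\<^sup>2 < \<kappa>\<^sup>2" using k by (intro power_strict_mono) auto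
      then have "\<epsilon> < 1 / (1 + k\<^sup>2)"
        using \<epsilon> by (simp add: \<kappa>2 field_simps add_pos_nonneg)
      also have "\<dots> \<le> prob {\<zeta>. d \<bullet> \<mu> + k * sqrt (d \<bullet> (S *v d)) \<le> d \<bullet> \<zeta>}"
        by (rule p(5))
      also have "\<dots> \<le> prob (space p - {\<zeta>. c + d \<bullet> \<zeta> \<le> 0})"
        using gt by (intro finite_measure_mono) (auto simp: sp p(2))
      also have "\<dots> = 1 - prob {\<zeta>. c + d \<bullet> \<zeta> \<le> 0}"
        by (rule prob_compl) (simp add: p(2))
      finally have "prob {\<zeta>. c + d \<bullet> \<zeta> \<le> 0} < 1 - \<epsilon>" by simp
      moreover have "?I \<le> prob {\<zeta>. c + d \<bullet> \<zeta> \<le> 0}"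
      proof (rule cINF_lower)
        show "bdd_below ((\<lambda>p. measure p {\<zeta>. c + d \<bullet> \<zeta> \<le> 0}) ` ambiguity_set U\<mu> US)"
          by (rule bdd_belowI2[of _ 0]) simp
        show "p \<in> ambiguity_set U\<mu> US"
          using p \<open>\<mu> \<in> U\<mu>\<close> \<open>S \<in> US\<close> by (auto simp: ambiguity_set_def)
      qed
      ultimately show False using I by simp
    qed
    then have "\<kappa> * sqrt (d \<bullet> (S *v d)) \<le> - (c + d \<bullet> \<mu>)"
      by (rule field_le_mult_one_interval)
    then show "c + d \<bullet> \<mu> + \<kappa> * sqrt (d \<bullet> (S *v d)) \<le> 0" by simp
  qed
next
  assume R: ?R
  show "?I \<ge> 1 - \<epsilon>"
  proof (rule cINF_greatest)
    \<comment> \<open>A lower bound on a real infimum needs a nonempty family; the law built with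
      \<open>k = 1\<close> is one member.\<close>
    obtain \<mu> S where "\<mu> \<in> U\<mu>" "S \<in> US" using ne by blast
    obtain p where "prob_space p" "sets p = sets borel" "has_mean_vector p \<mu>"
        "has_covariance_matrix p S"
      using worst_case_distribution_exists[OF psd[OF \<open>S \<in> US\<close>] zero_less_one] by metis
    then show "ambiguity_set U\<mu> US \<noteq> {}"
      using \<open>\<mu> \<in> U\<mu>\<close> \<open>S \<in> US\<close> by (auto simp: ambiguity_set_def)
  next
    fix p assume "p \<in> ambiguity_set U\<mu> US"
    then obtain \<mu> S where "prob_space p" "sets p = sets borel" "\<mu> \<in> U\<mu>" "has_mean_vector p \<mu>"
        "S \<in> US" "has_covariance_matrix p S"
      by (auto simp: ambiguity_set_def)
    then show "1 - \<epsilon> \<le> measure p {\<zeta>. c + d \<bullet> \<zeta> \<le> 0}"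
      using R chance_constraint_of_moments[OF _ _ _ _ \<epsilon> \<kappa>] by blast
  qed
qed

section \<open>The uncertainty sets and their support functions\<close>

lemma frobenius_eq_inner: "frobenius X Y = X \<bullet> Y"
  unfolding frobenius_def trace_def matrix_matrix_mult_def transpose_def inner_vec_def
  by (simp, subst sum.swap, rule refl)

lemma sum_UNIV_Plus:
  fixes f :: "'a::finite + 'b::finite \<Rightarrow> 'c::comm_monoid_add"
  shows "sum f UNIV = (\<Sum>i\<in>UNIV. f (Inl i)) + (\<Sum>j\<in>UNIV. f (Inr j))"
  by (simp add: sum.Plus o_def flip: UNIV_Plus_UNIV)

text \<open>Splits a vector of the sum-indexed space into its block \<open>v\<close> and last entry
  \<open>t\<close>; the borders are transposes of each other, so symmetry rests on \<open>W\<close>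
  alone.\<close>

lemma psd_bordered_iff:
  fixes W :: "real^'n^'n" and b :: "real^'n"
  shows "psd (block_matrix W (columnvector b :: real^1^'n) (rowvector b :: real^'n^1)
      (mat z :: real^1^1)) \<longleftrightarrow>
    W \<in> symmetric_mats \<and> (\<forall>v t. 0 \<le> v \<bullet> (W *v v) + 2 * t * (b \<bullet> v) + t\<^sup>2 * z)"
    (is "psd ?M \<longleftrightarrow> _")
proof -
  have sym: "?M \<in> symmetric_mats \<longleftrightarrow> W \<in> symmetric_mats"
  proof
    assume "?M \<in> symmetric_mats"
    then have "\<forall>i j. ?M $ Inl j $ Inl i = ?M $ Inl i $ Inl j"
      unfolding symmetric_mats_def mem_Collect_eq vec_eq_iff transpose_def by simp
    then show "W \<in> symmetric_mats"
      by (simp add: block_matrix_def symmetric_mats_def transpose_def vec_eq_iff)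
  next
    assume "W \<in> symmetric_mats"
    then show "?M \<in> symmetric_mats"
      by (auto simp: block_matrix_def symmetric_mats_def transpose_def vec_eq_iff mat_def
          columnvector_def rowvector_def split: sum.splits)
  qed
  have quad: "x \<bullet> (?M *v x) = v \<bullet> (W *v v) + 2 * t * (b \<bullet> v) + t\<^sup>2 * z"
    if v: "v = (\<chi> i. x $ Inl i)" and t: "t = x $ Inr 1" for x v t
  proof -
    have "x \<bullet> (?M *v x) =
        (\<Sum>i\<in>UNIV. x $ Inl i * ((\<Sum>j\<in>UNIV. W $ i $ j * x $ Inl j) + b $ i * t))
        + t * ((\<Sum>j\<in>UNIV. b $ j * x $ Inl j) + z * t)"
      by (simp add: inner_vec_def matrix_vector_mult_def sum_UNIV_Plus block_matrix_def
          columnvector_def rowvector_def mat_def t)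
    also have "\<dots> = v \<bullet> (W *v v) + 2 * t * (b \<bullet> v) + t\<^sup>2 * z"
      by (simp add: inner_vec_def matrix_vector_mult_def v distrib_left sum.distrib
          power2_eq_square sum_distrib_left ac_simps)
    finally show ?thesis .
  qed
  have "(\<forall>x. 0 \<le> x \<bullet> (?M *v x)) \<longleftrightarrow>
      (\<forall>v t. 0 \<le> v \<bullet> (W *v v) + 2 * t * (b \<bullet> v) + t\<^sup>2 * z)"
  proof (intro iffI allI)
    fix v t assume nonneg: "\<forall>x. 0 \<le> x \<bullet> (?M *v x)"
    define x :: "real^('n + 1)"
      where "x = (\<chi> i. case i of Inl a \<Rightarrow> v $ a | Inr _ \<Rightarrow> t)"
    show "0 \<le> v \<bullet> (W *v v) + 2 * t * (b \<bullet> v) + t\<^sup>2 * z"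
      using quad[of v x t] nonneg[rule_format, of x] by (simp add: x_def)
  next
    fix x assume "\<forall>v t. 0 \<le> v \<bullet> (W *v v) + 2 * t * (b \<bullet> v) + t\<^sup>2 * z"
    then show "0 \<le> x \<bullet> (?M *v x)"
      using quad[OF refl refl, of x] by simp
  qed
  then show ?thesis
    unfolding psd_def sym by simp
qed

section \<open>Dual norms on boxes and the support functions of the perturbation sets\<close>

lemma infnorm_le_iff:
  fixes z :: "real^'n"
  shows "infnorm z \<le> \<alpha> \<longleftrightarrow> (\<forall>i. \<bar>z $ i\<bar> \<le> \<alpha>)"
proof
  assume "\<forall>i. \<bar>z $ i\<bar> \<le> \<alpha>"
  then show "infnorm z \<le> \<alpha>"
    unfolding infnorm_cart by (intro cSup_least) auto
qed (meson component_le_infnorm_cart order_trans)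

lemma norm_inf_inf_le_iff: "norm_inf_inf Z \<le> \<beta> \<longleftrightarrow> (\<forall>i j. \<bar>Z $ i $ j\<bar> \<le> \<beta>)"
  unfolding norm_inf_inf_def by (subst Max_le_iff) auto

lemma mult_le_abs_bound:
  fixes x y a :: real
  assumes "\<bar>y\<bar> \<le> a"
  shows "x * y \<le> a * \<bar>x\<bar>"
proof -
  have "x * y \<le> \<bar>y\<bar> * \<bar>x\<bar>"
    by (metis abs_ge_self abs_mult mult.commute)
  also have "\<dots> \<le> a * \<bar>x\<bar>"
    using assms by (intro mult_right_mono) auto
  finally show ?thesis .
qed

lemma mult_scaled_sgn: "x * (a * sgn x) = a * \<bar>x :: real\<bar>"
  by (simp add: abs_sgn)

lemma abs_scaled_sgn_le: "a \<ge> 0 \<Longrightarrow> \<bar>a * sgn x\<bar> \<le> (a::real)"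
  by (simp add: abs_mult abs_sgn_eq)

text \<open>A linear functional on a box is maximised coordinatewise, at \<open>\<alpha>\<close>
  times the sign pattern of \<open>u\<close>.\<close>

lemma norm_1_dual:
  fixes u :: "real^'n"
  assumes "\<alpha> \<ge> 0"
  shows "infnorm z \<le> \<alpha> \<Longrightarrow> u \<bullet> z \<le> \<alpha> * norm_1 u"
    and "\<exists>z. infnorm z \<le> \<alpha> \<and> u \<bullet> z = \<alpha> * norm_1 u"
proof -
  assume "infnorm z \<le> \<alpha>"
  then show "u \<bullet> z \<le> \<alpha> * norm_1 u"
    unfolding infnorm_le_iff inner_vec_def norm_1_def sum_distrib_left inner_real_def
    by (intro sum_mono mult_le_abs_bound) blast
next
  let ?z = "\<chi> i. \<alpha> * sgn (u $ i)"
  have "infnorm ?z \<le> \<alpha>"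
    unfolding infnorm_le_iff using abs_scaled_sgn_le[OF assms] by simp
  moreover have "u \<bullet> ?z = \<alpha> * norm_1 u"
    unfolding inner_vec_def norm_1_def sum_distrib_left inner_real_def vec_lambda_beta
      mult_scaled_sgn ..
  ultimately show "\<exists>z. infnorm z \<le> \<alpha> \<and> u \<bullet> z = \<alpha> * norm_1 u"
    by blast
qed

text \<open>The sign pattern of a symmetric \<open>M\<close> is itself symmetric, so restricting
  \<open>Z\<close> to symmetric matrices does not lower the maximum.\<close>

lemma norm_1_1_dual:
  fixes M :: "real^'n^'n"
  assumes "\<beta> \<ge> 0"
  shows "norm_inf_inf Z \<le> \<beta> \<Longrightarrow> M \<bullet> Z \<le> \<beta> * norm_1_1 M"
    and "M \<in> symmetric_mats \<Longrightarrow>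
      \<exists>Z\<in>symmetric_mats. norm_inf_inf Z \<le> \<beta> \<and> M \<bullet> Z = \<beta> * norm_1_1 M"
proof -
  assume "norm_inf_inf Z \<le> \<beta>"
  then show "M \<bullet> Z \<le> \<beta> * norm_1_1 M"
    unfolding norm_inf_inf_le_iff inner_vec_def norm_1_1_def sum_distrib_left inner_real_def
    by (intro sum_mono mult_le_abs_bound) blast
next
  assume M: "M \<in> symmetric_mats"
  let ?Z = "\<chi> i j. \<beta> * sgn (M $ i $ j)"
  have "?Z \<in> symmetric_mats"
    using M by (simp add: symmetric_mats_def transpose_def vec_eq_iff)
  moreover have "norm_inf_inf ?Z \<le> \<beta>"
    unfolding norm_inf_inf_le_iff using abs_scaled_sgn_le[OF assms] by simp
  moreover have "M \<bullet> ?Z = \<beta> * norm_1_1 M"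
    unfolding inner_vec_def norm_1_1_def sum_distrib_left inner_real_def vec_lambda_beta
      mult_scaled_sgn ..
  ultimately show "\<exists>Z\<in>symmetric_mats. norm_inf_inf Z \<le> \<beta> \<and> M \<bullet> Z = \<beta> * norm_1_1 M"
    by blast
qed

lemma inner_le_mean_uncertainty:
  assumes "\<alpha> \<ge> 0" "\<mu> \<in> mean_uncertainty \<mu>t A \<alpha>"
  shows "d \<bullet> \<mu> \<le> d \<bullet> \<mu>t + \<alpha> * norm_1 (transpose A *v d)"
  using assms norm_1_dual(1)[OF assms(1)]
  by (auto simp: mean_uncertainty_def inner_add_right simp flip: dot_lmul_matrix)

lemma mean_uncertainty_attained:
  assumes "\<alpha> \<ge> 0"
  obtains \<mu> where "\<mu> \<in> mean_uncertainty \<mu>t A \<alpha>"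
    "d \<bullet> \<mu> = d \<bullet> \<mu>t + \<alpha> * norm_1 (transpose A *v d)"
proof -
  obtain z where "infnorm z \<le> \<alpha>" "(transpose A *v d) \<bullet> z = \<alpha> * norm_1 (transpose A *v d)"
    using norm_1_dual(2)[OF assms] by blast
  then show ?thesis
    by (intro that[of "\<mu>t + A *v z"])
      (auto simp: mean_uncertainty_def inner_add_right dot_lmul_matrix)
qed

text \<open>The covariance set before intersection with the psd cone: an affine image of a box, with
  an explicit support function at symmetric \<open>W\<close>. The cone is left to duality.\<close>

definition cov_perturbations :: "real^'n^'n \<Rightarrow> real^'k^'n \<Rightarrow> real \<Rightarrow> (real^'n^'n) set"
  where "cov_perturbations S B \<beta> =
    {S + B ** Z ** transpose B | Z. norm_inf_inf Z \<le> \<beta> \<and> Z \<in> symmetric_mats}"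

lemma mem_cov_uncertainty_iff:
  "Q \<in> cov_uncertainty S B \<beta> \<longleftrightarrow> Q \<in> cov_perturbations S B \<beta> \<and> psd Q"
  by (simp add: cov_uncertainty_def cov_perturbations_def)

lemma congruence_symmetric:
  assumes "Z \<in> symmetric_mats"
  shows "B ** Z ** transpose B \<in> symmetric_mats"
  using assms by (simp add: symmetric_mats_def matrix_transpose_mul matrix_mul_assoc)

lemma linear_congruence: "linear (\<lambda>Z::real^'k^'k. (B::real^'k^'n) ** Z ** transpose B)"
  by (rule linearI) (simp_all add: matrix_matrix_mult_def vec_eq_iff transpose_def
      algebra_simps sum.distrib sum_distrib_left)

lemma convex_cov_perturbations: "convex (cov_perturbations S B \<beta>)"
proof -
  have "convex {Z :: real^'k^'k. \<forall>i j. \<bar>Z $ i $ j\<bar> \<le> \<beta>}"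
  proof (intro convexI CollectI allI)
    fix Y Z :: "real^'k^'k" and u v :: real and i j
    assume "Y \<in> {Z. \<forall>i j. \<bar>Z $ i $ j\<bar> \<le> \<beta>}" "Z \<in> {Z. \<forall>i j. \<bar>Z $ i $ j\<bar> \<le> \<beta>}"
      and uv: "0 \<le> u" "0 \<le> v" "u + v = 1"
    then have "u * \<bar>Y $ i $ j\<bar> + v * \<bar>Z $ i $ j\<bar> \<le> \<beta>"
      by (intro convex_bound_le) auto
    moreover have "\<bar>u * Y $ i $ j + v * Z $ i $ j\<bar> \<le> u * \<bar>Y $ i $ j\<bar> + v * \<bar>Z $ i $ j\<bar>"
      using abs_triangle_ineq[of "u * Y $ i $ j" "v * Z $ i $ j"] uv by (simp add: abs_mult)
    ultimately show "\<bar>(u *\<^sub>R Y + v *\<^sub>R Z) $ i $ j\<bar> \<le> \<beta>"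
      by simp
  qed
  then have "convex ({Z :: real^'k^'k. norm_inf_inf Z \<le> \<beta>} \<inter> symmetric_mats)"
    unfolding norm_inf_inf_le_iff
    by (rule convex_Int[OF _ subspace_imp_convex[OF symmetric_mats_subspace]])
  then have "convex ((+) S ` (\<lambda>Z. B ** Z ** transpose B) `
      ({Z. norm_inf_inf Z \<le> \<beta>} \<inter> symmetric_mats))"
    by (intro convex_translation convex_linear_image linear_congruence)
  moreover have "cov_perturbations S B \<beta> = (+) S ` (\<lambda>Z. B ** Z ** transpose B) `
      ({Z. norm_inf_inf Z \<le> \<beta>} \<inter> symmetric_mats)"
    by (auto simp: cov_perturbations_def)
  ultimately show ?thesis by simp
qed

lemma cov_perturbations_symmetric:
  assumes "S \<in> symmetric_mats"
  shows "cov_perturbations S B \<beta> \<subseteq> symmetric_mats"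
  using assms by (auto simp: cov_perturbations_def
      intro!: subspace_add[OF symmetric_mats_subspace] congruence_symmetric)

lemma center_mem_cov_perturbations:
  assumes "\<beta> \<ge> 0"
  shows "S \<in> cov_perturbations S B \<beta>"
proof -
  have "B ** 0 ** transpose B = 0"
    by (simp add: matrix_matrix_mult_def vec_eq_iff)
  moreover have "norm_inf_inf (0::real^'k^'k) \<le> \<beta>" "(0::real^'k^'k) \<in> symmetric_mats"
    using assms by (auto simp: norm_inf_inf_le_iff subspace_0[OF symmetric_mats_subspace])
  ultimately show ?thesis
    unfolding cov_perturbations_def by force
qed

text \<open>Cyclicity of the trace moves both factors \<open>B\<close> from the perturbation to the
  multiplier.\<close>

lemma inner_congruence:
  fixes B :: "real^'k^'n"
  shows "W \<bullet> (B ** Z ** transpose B) = (transpose B ** W ** B) \<bullet> Z"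
proof -
  have "W \<bullet> (B ** Z ** transpose B) = trace (transpose W ** B ** Z ** transpose B)"
    by (simp add: frobenius_def matrix_mul_assoc flip: frobenius_eq_inner)
  also have "\<dots> = trace (transpose B ** (transpose W ** B ** Z))"
    by (rule trace_mul_sym)
  also have "\<dots> = (transpose B ** W ** B) \<bullet> Z"
    by (simp add: frobenius_def matrix_mul_assoc matrix_transpose_mul flip: frobenius_eq_inner)
  finally show ?thesis .
qed

lemma inner_le_cov_perturbations:
  assumes "\<beta> \<ge> 0" "Q \<in> cov_perturbations S B \<beta>"
  shows "W \<bullet> Q \<le> frobenius S W + \<beta> * norm_1_1 (transpose B ** W ** B)"
  using assms norm_1_1_dual(1)[OF assms(1)]
  by (auto simp: cov_perturbations_def inner_add_right inner_congruence frobenius_eq_inner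
      inner_commute)

lemma cov_perturbations_attained:
  assumes "\<beta> \<ge> 0" "W \<in> symmetric_mats"
  obtains Q where "Q \<in> cov_perturbations S B \<beta>"
    "W \<bullet> Q = frobenius S W + \<beta> * norm_1_1 (transpose B ** W ** B)"
proof -
  have "transpose B ** W ** B \<in> symmetric_mats"
    using congruence_symmetric[OF assms(2), of "transpose B"] by simp
  then obtain Z where "Z \<in> symmetric_mats" "norm_inf_inf Z \<le> \<beta>"
    "(transpose B ** W ** B) \<bullet> Z = \<beta> * norm_1_1 (transpose B ** W ** B)"
    using norm_1_1_dual(2)[OF assms(1)] by blast
  then show ?thesis
    by (intro that[of "S + B ** Z ** transpose B"])
      (auto simp: cov_perturbations_def inner_add_right inner_congruence frobenius_eq_inner
        inner_commute)
qed

section \<open>From the square-root constraint to the linear matrix inequality\<close>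

text \<open>With \<open>s = d \<bullet> (S *v d)\<close> positive, this pairs the bordered matrix
  with the psd matrix having blocks \<open>S\<close>,
  \<open>- (\<kappa> / sqrt s) *\<^sub>R (S *v d)\<close> and \<open>\<kappa>\<^sup>2\<close>,
  written as a sum of rank-one terms built from \<open>w i\<close> and \<open>t i\<close>.\<close>

lemma bordered_weak_duality:
  fixes W S :: "real^'n^'n"
  assumes "psd S" and bordered: "\<And>v t. 0 \<le> v \<bullet> (W *v v) + t * (d \<bullet> v) + t\<^sup>2 * z"
  shows "\<kappa> * sqrt (d \<bullet> (S *v d)) \<le> W \<bullet> S + \<kappa>\<^sup>2 * z"
proof -
  obtain N :: nat and w where S: "S = (\<Sum>i\<le>N. outer (w i))"
    using psd_eq_sum_outer[OF assms(1)] .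
  define s where "s = d \<bullet> (S *v d)"
  have s: "s = (\<Sum>i\<le>N. (d \<bullet> w i)\<^sup>2)"
    unfolding s_def S inner_outer[symmetric] inner_sum_left inner_outer_outer
    by (simp add: inner_commute)
  have WS: "W \<bullet> S = (\<Sum>i\<le>N. w i \<bullet> (W *v w i))"
    by (simp add: S inner_sum_right inner_outer)
  show ?thesis
  proof (cases "s = 0")
    case True
    have "W \<bullet> S \<ge> 0"
      unfolding WS using bordered[of _ 0] by (intro sum_nonneg) simp
    moreover have "z \<ge> 0"
      using bordered[of 0 1] by simp
    ultimately show ?thesis
      using True by (simp add: s_def)
  next
    case False
    moreover have "s \<ge> 0"
      unfolding s by (intro sum_nonneg) simp
    ultimately have "s > 0" by simp
    define t where "t i = - (\<kappa> / sqrt s) * (d \<bullet> w i)" for i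
    have "0 \<le> (\<Sum>i\<le>N. w i \<bullet> (W *v w i) + t i * (d \<bullet> w i) + (t i)\<^sup>2 * z)"
      by (intro sum_nonneg bordered)
    also have "\<dots> = (\<Sum>i\<le>N. w i \<bullet> (W *v w i) + (- (\<kappa> / sqrt s)) * (d \<bullet> w i)\<^sup>2
        + ((\<kappa> / sqrt s)\<^sup>2 * z) * (d \<bullet> w i)\<^sup>2)"
      by (intro sum.cong refl) (simp add: t_def power2_eq_square algebra_simps)
    also have "\<dots> = W \<bullet> S + (- (\<kappa> / sqrt s)) * s + ((\<kappa> / sqrt s)\<^sup>2 * z) * s"
      unfolding sum.distrib WS s sum_distrib_left by simp
    also have "(- (\<kappa> / sqrt s)) * s = - (\<kappa> * sqrt s)"
      using \<open>s > 0\<close> by (simp add: field_simps)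
    also have "((\<kappa> / sqrt s)\<^sup>2 * z) * s = \<kappa>\<^sup>2 * z"
      using \<open>s > 0\<close> by (simp add: power_divide)
    finally show ?thesis by (simp add: s_def)
  qed
qed

text \<open>From right to left, weak duality meets the support-function bound. The converse squares
  the constraint, takes the multiplier from the duality lemma and rescales it.\<close>

lemma robust_constraint_iff_bordered:
  fixes d :: "real^'n" and B :: "real^'k^'n" and \<Sigma> :: "real^'n^'n"
  assumes "\<kappa> > 0" "\<beta> \<ge> 0" and pd: "pos_def \<Sigma>"
  shows "(\<forall>S\<in>cov_uncertainty \<Sigma> B \<beta>. m + \<kappa> * sqrt (d \<bullet> (S *v d)) \<le> 0) \<longleftrightarrow>
    (\<exists>z W. W \<in> symmetric_mats \<and>
      m + frobenius \<Sigma> W + \<beta> * norm_1_1 (transpose B ** W ** B) + \<kappa>\<^sup>2 * z \<le> 0 \<and>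
      (\<forall>v t. 0 \<le> v \<bullet> (W *v v) + t * (d \<bullet> v) + t\<^sup>2 * z))" (is "?L \<longleftrightarrow> ?R")
proof
  assume ?R
  then obtain z W where le:
      "m + frobenius \<Sigma> W + \<beta> * norm_1_1 (transpose B ** W ** B) + \<kappa>\<^sup>2 * z \<le> 0"
    and bordered: "\<And>v t. 0 \<le> v \<bullet> (W *v v) + t * (d \<bullet> v) + t\<^sup>2 * z" by blast
  show ?L
  proof
    fix S assume "S \<in> cov_uncertainty \<Sigma> B \<beta>"
    then have S: "S \<in> cov_perturbations \<Sigma> B \<beta>" "psd S"
      by (auto simp: mem_cov_uncertainty_iff)
    show "m + \<kappa> * sqrt (d \<bullet> (S *v d)) \<le> 0"
      using bordered_weak_duality[OF S(2) bordered, of \<kappa>]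
        inner_le_cov_perturbations[OF \<open>\<beta> \<ge> 0\<close> S(1), of W] le by linarith
  qed
next
  assume L: ?L
  have \<Sigma>: "\<Sigma> \<in> symmetric_mats" "psd \<Sigma>"
    using pd pos_def_imp_psd by (auto simp: pos_def_def)
  note center = center_mem_cov_perturbations[OF \<open>\<beta> \<ge> 0\<close>, of \<Sigma> B]
  have m\<Sigma>: "m + \<kappa> * sqrt (d \<bullet> (\<Sigma> *v d)) \<le> 0"
    using L center \<Sigma>(2) by (simp add: mem_cov_uncertainty_iff)
  show ?R
  proof (cases "d = 0")
    \<comment> \<open>Without a linear term, \<open>z = 0\<close> and \<open>W = 0\<close> suffice
      because \<open>m \<le> 0\<close>.\<close>
    case True
    have "norm_1_1 (transpose B ** 0 ** B) = 0"
      by (simp add: norm_1_1_def matrix_matrix_mult_def)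
    then show ?thesis
      using m\<Sigma> True
      by (intro exI[of _ 0]) (simp add: frobenius_eq_inner subspace_0[OF symmetric_mats_subspace])
  next
    case False
    then have "d \<bullet> (\<Sigma> *v d) > 0"
      using pd by (simp add: pos_def_def)
    then have "\<kappa> * sqrt (d \<bullet> (\<Sigma> *v d)) > 0"
      using \<open>\<kappa> > 0\<close> by simp
    then have "m < 0" using m\<Sigma> by linarith
    \<comment> \<open>Squaring makes the constraint linear in \<open>S\<close>.\<close>
    have bound: "d \<bullet> (S *v d) \<le> (m / \<kappa>)\<^sup>2"
      if "S \<in> cov_perturbations \<Sigma> B \<beta>" "psd S" for S
    proof -
      have "m + \<kappa> * sqrt (d \<bullet> (S *v d)) \<le> 0"
        using L that by (simp add: mem_cov_uncertainty_iff)
      then have "sqrt (d \<bullet> (S *v d)) \<le> - m / \<kappa>"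
        using \<open>\<kappa> > 0\<close> by (simp add: field_simps)
      then have "d \<bullet> (S *v d) \<le> (- m / \<kappa>)\<^sup>2"
        by (rule sqrt_le_D)
      then show ?thesis by simp
    qed
    obtain W where W: "W \<in> symmetric_mats" "\<And>v. (d \<bullet> v)\<^sup>2 \<le> v \<bullet> (W *v v)"
      "\<And>S. S \<in> cov_perturbations \<Sigma> B \<beta> \<Longrightarrow> W \<bullet> S \<le> (m / \<kappa>)\<^sup>2"
      using psd_quadratic_form_duality[OF convex_cov_perturbations
          cov_perturbations_symmetric[OF \<Sigma>(1)] center pd bound] by blast
    text \<open>Scaling chosen so that \<open>4 * l * z = 1\<close> and both dual terms equal \<open>- m / 2\<close>.\<close>
    define l where "l = \<kappa>\<^sup>2 / (- 2 * m)"
    define z where "z = - m / (2 * \<kappa>\<^sup>2)"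
    have "l > 0" using \<open>m < 0\<close> \<open>\<kappa> > 0\<close> by (simp add: l_def divide_pos_neg)
    have z: "z = 1 / (4 * l)"
      using \<open>m < 0\<close> \<open>\<kappa> > 0\<close> by (simp add: l_def z_def field_simps)
    have lW: "l *\<^sub>R W \<in> symmetric_mats"
      using W(1) by (rule subspace_scale[OF symmetric_mats_subspace])
    \<comment> \<open>\<open>Q\<close> maximises over all perturbations, psd or not.
      \<open>W(3)\<close> covers these too, so the whole support function obeys the bound.\<close>
    obtain Q where Q: "Q \<in> cov_perturbations \<Sigma> B \<beta>" "(l *\<^sub>R W) \<bullet> Q =
        frobenius \<Sigma> (l *\<^sub>R W) + \<beta> * norm_1_1 (transpose B ** (l *\<^sub>R W) ** B)"
      using cov_perturbations_attained[OF \<open>\<beta> \<ge> 0\<close> lW] .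
    have "(l *\<^sub>R W) \<bullet> Q \<le> l * (m / \<kappa>)\<^sup>2"
      using W(3)[OF Q(1)] \<open>l > 0\<close> by simp
    also have "\<dots> = - m / 2"
      using \<open>m < 0\<close> \<open>\<kappa> > 0\<close> by (simp add: l_def power2_eq_square)
    finally have "m + ((l *\<^sub>R W) \<bullet> Q) + \<kappa>\<^sup>2 * z \<le> 0"
      using \<open>\<kappa> > 0\<close> by (simp add: z_def)
    moreover have "0 \<le> v \<bullet> ((l *\<^sub>R W) *v v) + t * (d \<bullet> v) + t\<^sup>2 * z" for v t
    proof -
      \<comment> \<open>The square produces exactly the cross term
        \<open>t * (d \<bullet> v)\<close> and, as \<open>z = 1 / (4 * l)\<close>, the term
        \<open>t\<^sup>2 * z\<close>.\<close>
      have "0 \<le> l * (d \<bullet> v + t / (2 * l))\<^sup>2"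
        using \<open>l > 0\<close> by simp
      also have "\<dots> = l * (d \<bullet> v)\<^sup>2 + t * (d \<bullet> v) + t\<^sup>2 * z"
        using \<open>l > 0\<close> by (simp add: z field_simps power2_eq_square)
      also have "l * (d \<bullet> v)\<^sup>2 \<le> v \<bullet> ((l *\<^sub>R W) *v v)"
        using W(2)[of v] \<open>l > 0\<close> by (simp flip: scaleR_matrix_vector_assoc)
      finally show ?thesis by simp
    qed
    ultimately show ?thesis
      using lW unfolding Q(2) add.assoc by blast
  qed
qed

section \<open>Assembly for the given mean and covariance sets\<close>

theorem mainTheorem5:
  fixes \<epsilon> \<kappa> \<alpha> \<beta> :: real
    and g :: "real^'n \<Rightarrow> real"
    and X :: "(real^'n) set"
    and \<mu>t xt :: "real^'n"
    and \<Sigma>t :: "real^'n^'n"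
    and A :: "real^'m^'n"
    and B :: "real^'k^'n"
  assumes "0 < \<epsilon>" and "\<epsilon> < 1"
    and "\<kappa> = sqrt ((1 - \<epsilon>) / \<epsilon>)"
    and "\<And>x. g differentiable (at x)"
    and "closed X"
    and "pos_def \<Sigma>t"
    and "\<alpha> \<ge> 0" and "\<beta> \<ge> 0"
    and "xt \<in> X"
  shows "(INF p \<in> ambiguity_set (mean_uncertainty \<mu>t A \<alpha>) (cov_uncertainty \<Sigma>t B \<beta>).
            measure p {\<zeta>. g xt + gradient g xt \<bullet> \<zeta> \<le> 0}) \<ge> 1 - \<epsilon>
    \<longleftrightarrow>
    (\<exists>(z::real) (W::real^'n^'n). W \<in> symmetric_mats \<and>
        g xt + gradient g xt \<bullet> \<mu>t + \<alpha> * norm_1 (transpose A *v gradient g xt)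
          + frobenius \<Sigma>t W + \<beta> * norm_1_1 (transpose B ** W ** B) + \<kappa>\<^sup>2 * z \<le> 0 \<and>
        psd (block_matrix W
               (columnvector ((1/2) *\<^sub>R gradient g xt) :: real^1^'n)
               (rowvector ((1/2) *\<^sub>R gradient g xt) :: real^'n^1)
               (mat z :: real^1^1)))"
proof -
  define d where "d = gradient g xt"
  define m where "m = g xt + d \<bullet> \<mu>t + \<alpha> * norm_1 (transpose A *v d)"
  let ?U = "mean_uncertainty \<mu>t A \<alpha>" and ?S = "cov_uncertainty \<Sigma>t B \<beta>"
  have "\<kappa> > 0" using assms(1-3) by simp
  obtain \<mu> where \<mu>: "\<mu> \<in> ?U" "d \<bullet> \<mu> = d \<bullet> \<mu>t + \<alpha> * norm_1 (transpose A *v d)"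
    using mean_uncertainty_attained[OF \<open>\<alpha> \<ge> 0\<close>] .
  have "psd \<Sigma>t"
    using \<open>pos_def \<Sigma>t\<close> by (rule pos_def_imp_psd)
  then have "\<Sigma>t \<in> ?S"
    using center_mem_cov_perturbations[OF \<open>\<beta> \<ge> 0\<close>] by (simp add: mem_cov_uncertainty_iff)
  have "(INF p \<in> ambiguity_set ?U ?S. measure p {\<zeta>. g xt + d \<bullet> \<zeta> \<le> 0}) \<ge> 1 - \<epsilon> \<longleftrightarrow>
      (\<forall>\<mu>\<in>?U. \<forall>S\<in>?S. g xt + d \<bullet> \<mu> + \<kappa> * sqrt (d \<bullet> (S *v d)) \<le> 0)"
    using \<mu>(1) \<open>\<Sigma>t \<in> ?S\<close>
    by (intro robust_chance_constraint_iff assms(1-3)) (auto simp: mem_cov_uncertainty_iff)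
  \<comment> \<open>Mean and covariance vary independently, and the maximum of
    \<open>d \<bullet> \<mu>\<close> is attained, so one mean vector is worst for every
    \<open>S\<close>.\<close>
  also have "\<dots> \<longleftrightarrow> (\<forall>S\<in>?S. m + \<kappa> * sqrt (d \<bullet> (S *v d)) \<le> 0)"
  proof -
    have le: "g xt + d \<bullet> \<nu> \<le> m" if "\<nu> \<in> ?U" for \<nu>
      using inner_le_mean_uncertainty[OF \<open>\<alpha> \<ge> 0\<close> that, of d] by (simp add: m_def)
    have eq: "g xt + d \<bullet> \<mu> = m"
      by (simp add: m_def \<mu>(2))
    show ?thesis (is "?l = ?r")
    proof
      assume ?l
      from bspec[OF this \<mu>(1)] show ?r unfolding eq .
    next
      assume r: ?r
      show ?l
      proof (intro ballI)
        fix \<nu> S assume "\<nu> \<in> ?U" "S \<in> ?S"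
        then show "g xt + d \<bullet> \<nu> + \<kappa> * sqrt (d \<bullet> (S *v d)) \<le> 0"
          using le[of \<nu>] r[rule_format, of S] by linarith
      qed
    qed
  qed
  also have "\<dots> \<longleftrightarrow> (\<exists>z W. W \<in> symmetric_mats \<and>
      m + frobenius \<Sigma>t W + \<beta> * norm_1_1 (transpose B ** W ** B) + \<kappa>\<^sup>2 * z \<le> 0 \<and>
      (\<forall>v t. 0 \<le> v \<bullet> (W *v v) + t * (d \<bullet> v) + t\<^sup>2 * z))"
    using \<open>\<kappa> > 0\<close> \<open>\<beta> \<ge> 0\<close> \<open>pos_def \<Sigma>t\<close> by (rule robust_constraint_iff_bordered)
  \<comment> \<open>For the border \<open>(1/2) *\<^sub>R d\<close> the doubled cross term of the
    bordered form becomes \<open>t * (d \<bullet> v)\<close>.\<close>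
  finally show ?thesis
    unfolding d_def[symmetric] m_def psd_bordered_iff by auto
qed

end
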